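(* Let $s\ge 1$, let $k_1,\dots,k_s$ be positive integers, and let $P=P(x_1,\dots,x_s,N)$ be a polynomial with rational coefficients of degree $q$. For $N\in\mathbb{Z}_{\ge 0}$ let $$f(N)=\sum_{\substack{x_1,\dots,x_s\in\mathbb{Z}_{\ge 0}\\ k_1x_1+\dots+k_sx_s\le N}}P(x_1,\dots,x_s,N).$$ Let $L$ be the least common multiple of $k_1,\dots,k_s$ and write $N=LM+R$ with $0\le R<L$ ($M,R\in\mathbb{Z}_{\ge 0}$). Then for every fixed $R$, $f(N)=f(LM+R)$ is a polynomial in $N$ (or equivalently in $M$) of degree at most $q+s$. *)

theory Defs
  imports
    Complex_Main
    "HOL-Library.Poly_Mapping"
    "HOL-Library.FuncSet"
    "HOL-Computational_Algebra.Polynomial"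
begin

text \<open>
  A multivariate polynomial is a finitely supported map from monomials to coefficients,
  a monomial being a finitely supported map from variable indices to exponents.
\<close>

type_synonym 'a mpoly = "(nat \<Rightarrow>\<^sub>0 nat) \<Rightarrow>\<^sub>0 'a"

definition mpoly_vars :: "'a::zero mpoly \<Rightarrow> nat set" where
  "mpoly_vars P = (\<Union>m\<in>Poly_Mapping.keys P. Poly_Mapping.keys m)"

definition monom_degree :: "(nat \<Rightarrow>\<^sub>0 nat) \<Rightarrow> nat" where
  "monom_degree m = (\<Sum>i\<in>Poly_Mapping.keys m. Poly_Mapping.lookup m i)"

text \<open>The zero polynomial gets total degree 0, as for \<^const>\<open>degree\<close>.\<close>

definition mpoly_degree :: "'a::zero mpoly \<Rightarrow> nat" where
  "mpoly_degree P = Max (insert 0 (monom_degree ` Poly_Mapping.keys P))"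

definition mpoly_eval :: "'a::comm_semiring_1 mpoly \<Rightarrow> (nat \<Rightarrow> 'a) \<Rightarrow> 'a" where
  "mpoly_eval P v =
    (\<Sum>m\<in>Poly_Mapping.keys P. Poly_Mapping.lookup P m *
       (\<Prod>i\<in>Poly_Mapping.keys m. v i ^ Poly_Mapping.lookup m i))"

text \<open>
  Tuples \<open>(x\<^sub>1, \<dots>, x\<^sub>s)\<close> are extensional functions on \<open>{1..s}\<close>, so that
  each tuple is counted exactly once.
\<close>

definition lattice_points :: "nat \<Rightarrow> (nat \<Rightarrow> nat) \<Rightarrow> nat \<Rightarrow> (nat \<Rightarrow> nat) set" where
  "lattice_points s k N = {x \<in> {1..s} \<rightarrow>\<^sub>E UNIV. (\<Sum>i=1..s. k i * x i) \<le> N}"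

text \<open>
  In \<open>P(x\<^sub>1, \<dots>, x\<^sub>s, N)\<close> the variables 1 to \<open>s\<close> stand for the \<open>x\<^sub>i\<close> and the
  variable \<open>s + 1\<close> for \<open>N\<close>.
\<close>

definition lattice_sum :: "nat \<Rightarrow> (nat \<Rightarrow> nat) \<Rightarrow> rat mpoly \<Rightarrow> nat \<Rightarrow> rat" where
  "lattice_sum s k P N =
    (\<Sum>x\<in>lattice_points s k N. mpoly_eval P (\<lambda>i. of_nat ((x(Suc s := N)) i)))"

end

theory Submission
  imports Defs
begin

text \<open>
  By linearity it suffices to treat a monomial \<open>x\<^sub>1\<^bsup>a\<^sub>1\<^esup> \<cdots> x\<^sub>s\<^bsup>a\<^sub>s\<^esup> N\<^bsup>e\<^esup>\<close>. Apart from the factor \<open>N\<^bsup>e\<^esup>\<close> its sum is the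
  Cauchy product of the constant sequence 1 with the sequences sending \<open>k\<^sub>i t\<close> to \<open>t\<^bsup>a\<^sub>i\<^esup>\<close> and
  non-multiples of \<open>k\<^sub>i\<close> to 0. Each of these is polynomial of degree at most \<open>a\<^sub>i\<close> on every residue
  class modulo \<open>L\<close>, and the Cauchy product of two such sequences of degrees \<open>d\<close> and \<open>e\<close> has degree
  at most \<open>d + e + 1\<close>, because a convolution of two polynomial sequences is polynomial.
\<close>

section \<open>Polynomial sequences with a degree bound\<close>

definition poly_seq :: "nat \<Rightarrow> (nat \<Rightarrow> 'a::field_char_0) \<Rightarrow> bool" where
  "poly_seq d u \<longleftrightarrow> (\<exists>p. degree p \<le> d \<and> (\<forall>n. u n = poly p (of_nat n)))"

text \<open>For positive \<open>L\<close> these are the quasi-polynomials of period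
  \<open>L\<close>. Each constituent is a polynomial in the quotient \<open>M\<close> rather than in
  \<open>L * M + R\<close>, so that convolutions run over quotients; the two descriptions differ by
  an affine substitution.\<close>

definition quasi_poly_seq :: "nat \<Rightarrow> nat \<Rightarrow> (nat \<Rightarrow> 'a::field_char_0) \<Rightarrow> bool" where
  "quasi_poly_seq L d u \<longleftrightarrow> (\<forall>R<L. poly_seq d (\<lambda>M. u (L * M + R)))"

lemma poly_seqI: "degree p \<le> d \<Longrightarrow> (\<And>n. u n = poly p (of_nat n)) \<Longrightarrow> poly_seq d u"
  unfolding poly_seq_def by blast

lemma poly_seqE:
  assumes "poly_seq d u"
  obtains p where "degree p \<le> d" "\<And>n. u n = poly p (of_nat n)"
  using assms unfolding poly_seq_def by blast

lemma poly_seq_mono: "poly_seq d u \<Longrightarrow> d \<le> e \<Longrightarrow> poly_seq e u"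
  unfolding poly_seq_def using le_trans by blast

lemma poly_seq_const: "poly_seq d (\<lambda>_. c)"
  by (rule poly_seqI[of "[:c:]"]) auto

lemma poly_seq_mult:
  assumes "poly_seq d u" "poly_seq e v"
  shows "poly_seq (d + e) (\<lambda>n. u n * v n)"
proof -
  obtain p where p: "degree p \<le> d" "\<And>n. u n = poly p (of_nat n)"
    using assms(1) by (rule poly_seqE) blast
  obtain q where q: "degree q \<le> e" "\<And>n. v n = poly q (of_nat n)"
    using assms(2) by (rule poly_seqE) blast
  show ?thesis
  proof (rule poly_seqI[of "p * q"])
    show "degree (p * q) \<le> d + e"
      using degree_mult_le[of p q] p(1) q(1) by linarith
  qed (simp add: p q)
qed

lemma poly_seq_cmult: "poly_seq d u \<Longrightarrow> poly_seq d (\<lambda>n. c * u n)"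
  using poly_seq_mult[OF poly_seq_const[of 0 c]] by simp

lemma poly_seq_diff:
  assumes "poly_seq d u" "poly_seq d v"
  shows "poly_seq d (\<lambda>n. u n - v n)"
proof -
  obtain p where p: "degree p \<le> d" "\<And>n. u n = poly p (of_nat n)"
    using assms(1) by (rule poly_seqE) blast
  obtain q where q: "degree q \<le> d" "\<And>n. v n = poly q (of_nat n)"
    using assms(2) by (rule poly_seqE) blast
  show ?thesis
    by (rule poly_seqI[of "p - q"]) (simp_all add: p q degree_diff_le)
qed

lemma poly_seq_sum:
  assumes "\<And>i. i \<in> A \<Longrightarrow> poly_seq d (u i)"
  shows "poly_seq d (\<lambda>n. \<Sum>i\<in>A. u i n)"
proof -
  have "\<forall>i\<in>A. \<exists>p. degree p \<le> d \<and> (\<forall>n. u i n = poly p (of_nat n))"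
    using assms unfolding poly_seq_def by blast
  then obtain p where p: "\<And>i. i \<in> A \<Longrightarrow> degree (p i) \<le> d"
      "\<And>i n. i \<in> A \<Longrightarrow> u i n = poly (p i) (of_nat n)"
    by metis
  show ?thesis
  proof (rule poly_seqI[of "\<Sum>i\<in>A. p i"])
    show "degree (\<Sum>i\<in>A. p i) \<le> d"
      by (cases "finite A") (auto intro: degree_sum_le p)
  qed (simp add: poly_sum p)
qed

text \<open>The base is linear in \<open>n\<close>, hence of degree at most 1 even when
  \<open>c = 0\<close>. A power takes this form along the indices \<open>c * n + b\<close>, that is,
  along a residue class.\<close>

lemma poly_seq_linear_power: "poly_seq a (\<lambda>n. (of_nat c * of_nat n + of_nat b) ^ a)"
proof (rule poly_seqI[of "[:of_nat b, of_nat c:] ^ a"])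
  have "degree ([:of_nat b, of_nat c:] ^ a :: 'a poly) \<le> degree [:of_nat b, of_nat c :: 'a:] * a"
    by (rule degree_power_le)
  also have "\<dots> \<le> 1 * a"
    by (intro mult_right_mono) auto
  finally show "degree ([:of_nat b, of_nat c:] ^ a :: 'a poly) \<le> a"
    by simp
qed (simp add: add.commute mult.commute)

section \<open>Power sums and convolutions of polynomials\<close>

lemma poly_seq_of_nat_power: "poly_seq a (\<lambda>n. of_nat n ^ a)"
  using poly_seq_linear_power[of a 1 0] by simp

text \<open>The recursion for power sums comes from telescoping \<open>(y + 1)\<^bsup>n+1\<^esup> - y\<^bsup>n+1\<^esup>\<close>.\<close>

lemma poly_seq_power_sum: "poly_seq (Suc n) (\<lambda>M. \<Sum>y\<le>M. of_nat y ^ n :: 'a::field_char_0)"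
proof (induction n rule: less_induct)
  case (less n)
  let ?S = "\<lambda>j M. \<Sum>y\<le>M. of_nat y ^ j :: 'a"
  have rec: "?S n M = inverse (of_nat (Suc n)) *
      ((of_nat 1 * of_nat M + of_nat 1) ^ Suc n - (\<Sum>j<n. of_nat (Suc n choose j) * ?S j M))" for M
  proof -
    have step: "of_nat (Suc y) ^ Suc n - of_nat y ^ Suc n =
        (\<Sum>j\<le>n. of_nat (Suc n choose j) * of_nat y ^ j :: 'a)" for y
    proof -
      have "of_nat (Suc y) ^ Suc n = (of_nat y + 1 :: 'a) ^ Suc n"
        by (simp add: add.commute)
      also have "\<dots> = (\<Sum>j\<le>Suc n. of_nat (Suc n choose j) * of_nat y ^ j)"
        by (subst binomial_ring) simp
      finally show ?thesis
        by simp
    qed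
    have "(of_nat 1 * of_nat M + of_nat 1) ^ Suc n =
        (\<Sum>y\<le>M. of_nat (Suc y) ^ Suc n - of_nat y ^ Suc n :: 'a)"
      by (induction M) (simp_all add: add.commute)
    also have "\<dots> = (\<Sum>y\<le>M. \<Sum>j\<le>n. of_nat (Suc n choose j) * of_nat y ^ j)"
      by (simp only: step)
    also have "\<dots> = (\<Sum>j\<le>n. of_nat (Suc n choose j) * ?S j M)"
      by (subst sum.swap) (simp add: sum_distrib_left)
    also have "\<dots> = (\<Sum>j<n. of_nat (Suc n choose j) * ?S j M) + of_nat (Suc n) * ?S n M"
      by (simp add: lessThan_Suc_atMost[symmetric])
    finally have "(of_nat 1 * of_nat M + of_nat 1) ^ Suc n - (\<Sum>j<n. of_nat (Suc n choose j) * ?S j M)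
        = of_nat (Suc n) * ?S n M"
      by simp
    \<comment> \<open>Characteristic zero permits the division by \<open>n + 1\<close> that isolates
      the top power sum.\<close>
    moreover have "(of_nat (Suc n) :: 'a) \<noteq> 0"
      by (rule of_nat_neq_0)
    ultimately show ?thesis
      by (simp del: of_nat_Suc)
  qed
  have "poly_seq (Suc n) (?S j)" if "j < n" for j
    using less.IH[OF that] by (rule poly_seq_mono) (use that in simp)
  then show ?case
    unfolding rec
    by (intro poly_seq_cmult poly_seq_diff poly_seq_sum poly_seq_linear_power) simp
qed

text \<open>The binomial theorem splits \<open>(M - y)^b\<close> into terms in
  \<open>M^(b - c) * y^c\<close>. Summing over \<open>y\<close> leaves \<open>M^(b - c)\<close>
  times a power sum of exponent \<open>a + c\<close>, and the degree bound
  \<open>(b - c) + (a + c + 1)\<close> is the same for all \<open>c\<close>.\<close>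

lemma poly_seq_power_convolution:
  "poly_seq (a + b + 1) (\<lambda>M. \<Sum>y\<le>M. of_nat y ^ a * (of_nat M - of_nat y) ^ b :: 'a::field_char_0)"
proof -
  have "(\<Sum>y\<le>M. of_nat y ^ a * (of_nat M - of_nat y) ^ b :: 'a) =
      (\<Sum>c\<le>b. (of_nat (b choose c) * (-1) ^ c) *
         (of_nat M ^ (b - c) * (\<Sum>y\<le>M. of_nat y ^ (a + c))))" for M
  proof -
    have "of_nat y ^ a * (of_nat M - of_nat y) ^ b =
        (\<Sum>c\<le>b. (of_nat (b choose c) * (-1) ^ c) * (of_nat M ^ (b - c) * of_nat y ^ (a + c)) :: 'a)"
      for y
    proof -
      have "(of_nat M - of_nat y) ^ b = (- of_nat y + of_nat M :: 'a) ^ b"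
        by simp
      also have "\<dots> = (\<Sum>c\<le>b. of_nat (b choose c) * (- of_nat y) ^ c * of_nat M ^ (b - c))"
        by (rule binomial_ring)
      finally show ?thesis
        by (simp add: sum_distrib_left power_add power_minus[of "of_nat y"] mult_ac)
    qed
    then have "(\<Sum>y\<le>M. of_nat y ^ a * (of_nat M - of_nat y) ^ b :: 'a) =
      (\<Sum>y\<le>M. \<Sum>c\<le>b. (of_nat (b choose c) * (-1) ^ c) * (of_nat M ^ (b - c) * of_nat y ^ (a + c)))"
      by simp
    also have "\<dots> = (\<Sum>c\<le>b. (of_nat (b choose c) * (-1) ^ c) *
         (of_nat M ^ (b - c) * (\<Sum>y\<le>M. of_nat y ^ (a + c))))"
      by (subst sum.swap) (simp add: sum_distrib_left)
    finally show ?thesis .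
  qed
  moreover have "poly_seq (a + b + 1)
      (\<lambda>M. of_nat M ^ (b - c) * (\<Sum>y\<le>M. of_nat y ^ (a + c)) :: 'a)" if "c \<le> b" for c
    using poly_seq_mult[OF poly_seq_of_nat_power poly_seq_power_sum]
    by (rule poly_seq_mono) (use that in simp)
  ultimately show ?thesis
    by (auto intro!: poly_seq_sum poly_seq_cmult)
qed

text \<open>The convolution is bilinear in \<open>p\<close> and \<open>q\<close>, so it reduces to
  pairs of monomials. The difference is taken in the field, where it can be expanded.\<close>

lemma poly_seq_convolution:
  fixes p q :: "'a::field_char_0 poly"
  assumes "degree p \<le> d" "degree q \<le> e"
  shows "poly_seq (d + e + 1) (\<lambda>M. \<Sum>y\<le>M. poly p (of_nat y) * poly q (of_nat M - of_nat y))"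
proof -
  have "(\<Sum>y\<le>M. poly p (of_nat y) * poly q (of_nat M - of_nat y)) =
      (\<Sum>a\<le>degree p. \<Sum>b\<le>degree q. (coeff p a * coeff q b) *
         (\<Sum>y\<le>M. of_nat y ^ a * (of_nat M - of_nat y) ^ b))" for M
  proof -
    have "(\<Sum>y\<le>M. poly p (of_nat y) * poly q (of_nat M - of_nat y)) =
      (\<Sum>y\<le>M. \<Sum>a\<le>degree p. \<Sum>b\<le>degree q. (coeff p a * coeff q b) *
         (of_nat y ^ a * (of_nat M - of_nat y) ^ b))"
      by (simp add: poly_altdef sum_product mult_ac)
    also have "\<dots> = (\<Sum>a\<le>degree p. \<Sum>b\<le>degree q. \<Sum>y\<le>M. (coeff p a * coeff q b) *
         (of_nat y ^ a * (of_nat M - of_nat y) ^ b))"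
      by (rule trans[OF sum.swap], rule sum.cong[OF refl], rule sum.swap)
    finally show ?thesis
      by (simp add: sum_distrib_left)
  qed
  moreover have "poly_seq (d + e + 1) (\<lambda>M. \<Sum>y\<le>M. of_nat y ^ a * (of_nat M - of_nat y) ^ b :: 'a)"
    if "a \<le> degree p" "b \<le> degree q" for a b
    using poly_seq_power_convolution by (rule poly_seq_mono) (use that assms in simp)
  ultimately show ?thesis
    by (auto intro!: poly_seq_sum poly_seq_cmult)
qed

text \<open>This serves the residues whose subtraction causes a borrow, so that the quotients add up
  to \<open>M - 1\<close>. The polynomial must also be right at \<open>M = 0\<close>, where the sum
  is empty and \<open>M - 1\<close> is truncated.\<close>

lemma poly_seq_shifted_convolution:
  fixes p q :: "'a::field_char_0 poly"
  assumes "degree p \<le> d" "degree q \<le> e"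
  shows "poly_seq (d + e + 1) (\<lambda>M. \<Sum>y<M. poly p (of_nat y) * poly q (of_nat (M - 1 - y)))"
proof -
  define q' where "q' = q \<circ>\<^sub>p [:-1, 1:]"
  have q': "degree q' \<le> e"
    using assms(2) by (simp add: q'_def degree_pcompose)
  \<comment> \<open>With \<open>q'(z) = q(z - 1)\<close> the sum can be extended to
    \<open>y = M\<close>. The added term is \<open>q(-1) * p(M)\<close>, and subtracting it gives
    the value 0 at \<open>M = 0\<close> too.\<close>
  have "(\<Sum>y<M. poly p (of_nat y) * poly q (of_nat (M - 1 - y))) =
      (\<Sum>y\<le>M. poly p (of_nat y) * poly q' (of_nat M - of_nat y)) -
      poly q (-1) * poly p (of_nat M)" for M
  proof -
    have "(\<Sum>y<M. poly p (of_nat y) * poly q (of_nat (M - 1 - y))) =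
        (\<Sum>y<M. poly p (of_nat y) * poly q' (of_nat M - of_nat y))"
    proof (rule sum.cong)
      fix y assume "y \<in> {..<M}"
      then have "of_nat (M - 1 - y) = (- 1 + (of_nat M - of_nat y) :: 'a)"
        by (simp add: of_nat_diff)
      then show "poly p (of_nat y) * poly q (of_nat (M - 1 - y)) =
          poly p (of_nat y) * poly q' (of_nat M - of_nat y)"
        by (simp add: q'_def poly_pcompose)
    qed simp
    then show ?thesis
      by (simp add: lessThan_Suc_atMost[symmetric] q'_def poly_pcompose)
  qed
  moreover have "poly_seq (d + e + 1) (\<lambda>M. poly p (of_nat M))"
    by (rule poly_seqI[of p]) (use assms in simp_all)
  ultimately show ?thesis
    using poly_seq_convolution[OF assms(1) q'] by (auto intro!: poly_seq_diff poly_seq_cmult)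
qed

section \<open>Quasi-polynomial sequences\<close>

lemma quasi_poly_seqD: "quasi_poly_seq L d u \<Longrightarrow> R < L \<Longrightarrow> poly_seq d (\<lambda>M. u (L * M + R))"
  unfolding quasi_poly_seq_def by blast

lemma quasi_poly_seq_mono: "quasi_poly_seq L d u \<Longrightarrow> d \<le> e \<Longrightarrow> quasi_poly_seq L e u"
  unfolding quasi_poly_seq_def using poly_seq_mono by blast

lemma quasi_poly_seq_const: "quasi_poly_seq L d (\<lambda>_. c)"
  unfolding quasi_poly_seq_def by (simp add: poly_seq_const)

lemma quasi_poly_seq_mult:
  "quasi_poly_seq L d u \<Longrightarrow> quasi_poly_seq L e v \<Longrightarrow> quasi_poly_seq L (d + e) (\<lambda>n. u n * v n)"
  unfolding quasi_poly_seq_def by (simp add: poly_seq_mult)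

lemma quasi_poly_seq_cmult: "quasi_poly_seq L d u \<Longrightarrow> quasi_poly_seq L d (\<lambda>n. c * u n)"
  unfolding quasi_poly_seq_def by (simp add: poly_seq_cmult)

lemma quasi_poly_seq_sum:
  "(\<And>i. i \<in> A \<Longrightarrow> quasi_poly_seq L d (u i)) \<Longrightarrow> quasi_poly_seq L d (\<lambda>n. \<Sum>i\<in>A. u i n)"
  unfolding quasi_poly_seq_def by (simp add: poly_seq_sum)

lemma quasi_poly_seq_of_nat_power: "quasi_poly_seq L a (\<lambda>n. of_nat n ^ a)"
  unfolding quasi_poly_seq_def by (simp add: poly_seq_linear_power)

text \<open>Since \<open>c\<close> divides \<open>L\<close>, whether \<open>c\<close> divides
  \<open>L * M + R\<close> depends on \<open>R\<close> alone. If it does, the quotient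
  \<open>(L div c) * M + R div c\<close> is linear in \<open>M\<close>; otherwise the sequence
  vanishes on the whole class.\<close>

lemma quasi_poly_seq_power_div:
  assumes "c dvd L"
  shows "quasi_poly_seq L a (\<lambda>n. if c dvd n then of_nat (n div c) ^ a else 0)"
  unfolding quasi_poly_seq_def
proof (intro allI impI)
  fix R
  have dvd: "c dvd L * M + R \<longleftrightarrow> c dvd R" for M
    using assms by (simp add: dvd_add_right_iff)
  have "(L * M + R) div c = L div c * M + R div c" if "c dvd R" for M
    using assms that by (simp add: div_plus_div_distrib_dvd_left dvd_div_mult)
  then show "poly_seq a (\<lambda>M. if c dvd L * M + R then of_nat ((L * M + R) div c) ^ a else 0 :: 'a)"
    by (cases "c dvd R") (simp_all add: dvd poly_seq_const poly_seq_linear_power)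
qed

section \<open>Residue classes and Cauchy products\<close>

lemma sum_residue_classes:
  fixes L M R :: nat and F :: "nat \<Rightarrow> 'a::comm_monoid_add"
  assumes "R < L"
  shows "(\<Sum>j\<le>L * M + R. F j) = (\<Sum>r<L. \<Sum>y<(if r \<le> R then Suc M else M). F (L * y + r))"
proof -
  \<comment> \<open>Unequal quotients decide the comparison, because both residues are below
    \<open>L\<close>; at \<open>y = M\<close> the residues decide. Hence only the classes with
    \<open>r \<le> R\<close> reach the quotient \<open>M\<close>.\<close>
  have le_iff: "L * y + r \<le> L * M + R \<longleftrightarrow> y < (if r \<le> R then Suc M else M)" if "r < L" for r y
  proof (cases y M rule: linorder_cases)
    case less
    then have "L * Suc y \<le> L * M"
      by (intro mult_left_mono) auto
    with less that show ?thesis by simp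
  next
    case greater
    then have "L * Suc M \<le> L * y"
      by (intro mult_left_mono) auto
    with greater assms show ?thesis by auto
  qed auto
  have "(\<Sum>r<L. \<Sum>y<(if r \<le> R then Suc M else M). F (L * y + r)) =
      (\<Sum>(r, y)\<in>(SIGMA r:{..<L}. {..<(if r \<le> R then Suc M else M)}). F (L * y + r))"
    by (rule sum.Sigma) auto
  also have "\<dots> = (\<Sum>j\<le>L * M + R. F j)"
  proof (rule sum.reindex_bij_witness[of _ "\<lambda>j. (j mod L, j div L)" "\<lambda>(r, y). L * y + r"])
    fix j assume "j \<in> {..L * M + R}"
    then have "L * (j div L) + j mod L \<le> L * M + R"
      by simp
    moreover have "j mod L < L"
      using assms by simp
    ultimately show "(j mod L, j div L) \<in> (SIGMA r:{..<L}. {..<(if r \<le> R then Suc M else M)})"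
      using le_iff by blast
  qed (use le_iff in auto)
  finally show ?thesis by simp
qed

text \<open>Splitting the sum by the residue \<open>r\<close> of \<open>j\<close> leaves, for each
  \<open>r\<close>, a convolution of two polynomials in the quotients. These add up to
  \<open>M\<close> if \<open>r \<le> R\<close>, and to \<open>M - 1\<close> otherwise.\<close>

lemma quasi_poly_seq_cauchy_product:
  fixes u v :: "nat \<Rightarrow> 'a::field_char_0"
  assumes u: "quasi_poly_seq L d u" and v: "quasi_poly_seq L e v"
  shows "quasi_poly_seq L (d + e + 1) (\<lambda>N. \<Sum>j\<le>N. u j * v (N - j))"
  unfolding quasi_poly_seq_def
proof (intro allI impI)
  fix R assume R: "R < L"
  have "poly_seq (d + e + 1)
      (\<lambda>M. \<Sum>y<(if r \<le> R then Suc M else M). u (L * y + r) * v (L * M + R - (L * y + r)))"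
    if r: "r < L" for r
  proof -
    obtain p where p: "degree p \<le> d" "\<And>y. u (L * y + r) = poly p (of_nat y)"
      using quasi_poly_seqD[OF u r] by (rule poly_seqE) blast
    show ?thesis
    proof (cases "r \<le> R")
      case True
      obtain q where q: "degree q \<le> e" "\<And>y. v (L * y + (R - r)) = poly q (of_nat y)"
        by (rule poly_seqE[OF quasi_poly_seqD[OF v, of "R - r"]]) (use R in auto)
      have "v (L * M + R - (L * y + r)) = poly q (of_nat M - of_nat y)" if "y \<le> M" for M y
      proof -
        have "L * M + R - (L * y + r) = L * (M - y) + (R - r)"
          using True that by (simp add: diff_mult_distrib2)
        then show ?thesis
          using q(2)[of "M - y"] that by (simp add: of_nat_diff)
      qed
      then show ?thesis
        using poly_seq_convolution[OF p(1) q(1)] True by (simp add: p(2) lessThan_Suc_atMost)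
    next
      case False
      \<comment> \<open>The subtraction borrows one block of length \<open>L\<close>: as
        \<open>R < r < L\<close>, the difference has residue \<open>L + R - r < L\<close> and
        quotient \<open>M - 1 - y\<close>.\<close>
      obtain q where q: "degree q \<le> e" "\<And>y. v (L * y + (L + R - r)) = poly q (of_nat y)"
        by (rule poly_seqE[OF quasi_poly_seqD[OF v, of "L + R - r"]]) (use False r in auto)
      have "v (L * M + R - (L * y + r)) = poly q (of_nat (M - 1 - y))" if "y < M" for M y
      proof -
        obtain z where z: "M = Suc (y + z)"
          using less_imp_Suc_add[OF \<open>y < M\<close>] by blast
        have "L * M + R - (L * y + r) = L * (M - 1 - y) + (L + R - r)"
          using False r by (simp add: z algebra_simps)
        then show ?thesis
          using q(2)[of "M - 1 - y"] by simp
      qed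
      then show ?thesis
        using poly_seq_shifted_convolution[OF p(1) q(1)] False by (simp add: p(2))
    qed
  qed
  then show "poly_seq (d + e + 1) (\<lambda>M. \<Sum>j\<le>L * M + R. u j * v (L * M + R - j))"
    unfolding sum_residue_classes[OF R] by (intro poly_seq_sum) simp
qed

section \<open>Sums over lattice points\<close>

lemma finite_lattice_points:
  assumes "\<And>i. i \<in> {1..s} \<Longrightarrow> k i > 0"
  shows "finite (lattice_points s k N)"
proof (rule finite_subset)
  show "lattice_points s k N \<subseteq> {1..s} \<rightarrow>\<^sub>E {..N}"
  proof
    fix x assume x: "x \<in> lattice_points s k N"
    have "x i \<le> N" if i: "i \<in> {1..s}" for i
    proof -
      have "x i \<le> k i * x i"
        using assms[OF i] by simp
      also have "\<dots> \<le> (\<Sum>i=1..s. k i * x i)"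
        by (rule member_le_sum[OF i]) auto
      also have "\<dots> \<le> N"
        using x by (simp add: lattice_points_def)
      finally show ?thesis .
    qed
    then show "x \<in> {1..s} \<rightarrow>\<^sub>E {..N}"
      using x by (auto simp: lattice_points_def PiE_iff)
  qed
qed (simp add: finite_PiE)

text \<open>Fixing the last coordinate \<open>t\<close> uses up \<open>j = k (Suc s) * t\<close> of
  the bound and leaves a point in \<open>s\<close> coordinates for the bound \<open>N - j\<close>.
  Indexing by \<open>j\<close>, with weight 0 at non-multiples, makes the sum a Cauchy
  product.\<close>

lemma sum_lattice_points_Suc:
  fixes w :: "nat \<Rightarrow> nat \<Rightarrow> 'a::comm_semiring_1"
  assumes k: "\<And>i. i \<in> {1..Suc s} \<Longrightarrow> k i > 0"
  shows "(\<Sum>x\<in>lattice_points (Suc s) k N. \<Prod>i=1..Suc s. w i (x i)) =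
    (\<Sum>j\<le>N. (if k (Suc s) dvd j then w (Suc s) (j div k (Suc s)) else 0) *
       (\<Sum>x\<in>lattice_points s k (N - j). \<Prod>i=1..s. w i (x i)))"
    (is "?lhs = (\<Sum>j\<le>N. ?u j * ?W (N - j))")
proof -
  define c where "c = k (Suc s)"
  have c: "c > 0"
    using k by (simp add: c_def)
  define T where "T = {t. c * t \<le> N}"
  have "t \<le> N" if "c * t \<le> N" for t
    using that c by (metis le_trans mult_le_mono1 nat_mult_1 Suc_leI One_nat_def)
  then have finT: "finite T"
    by (intro finite_subset[of T "{..N}"]) (auto simp: T_def)
  have sum_upd: "(\<Sum>i=1..s. k i * (if i = Suc s then b else x i)) = (\<Sum>i=1..s. k i * x i)"
    for x :: "nat \<Rightarrow> nat" and b
    by (rule sum.cong) auto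
  have "?lhs = (\<Sum>(t, x)\<in>(SIGMA t:T. lattice_points s k (N - c * t)).
      w (Suc s) t * (\<Prod>i=1..s. w i (x i)))"
  \<comment> \<open>Dropping the last coordinate means resetting it to \<open>undefined\<close>,
    since tuples are extensional; this makes the two maps mutually inverse.\<close>
  proof (rule sum.reindex_bij_witness[of _ "\<lambda>(t, x). x(Suc s := t)"
        "\<lambda>x. (x (Suc s), x(Suc s := undefined))"])
    fix x assume x: "x \<in> lattice_points (Suc s) k N"
    show "(case (x (Suc s), x(Suc s := undefined)) of (t, x) \<Rightarrow> x(Suc s := t)) = x"
      by simp
    show "(x (Suc s), x(Suc s := undefined)) \<in> (SIGMA t:T. lattice_points s k (N - c * t))"
      using x by (auto simp: lattice_points_def T_def c_def sum_upd PiE_iff extensional_def)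
    show "(case (x (Suc s), x(Suc s := undefined)) of
        (t, x) \<Rightarrow> w (Suc s) t * (\<Prod>i=1..s. w i (x i))) = (\<Prod>i=1..Suc s. w i (x i))"
      by (simp add: mult.commute)
  next
    fix y assume y: "y \<in> (SIGMA t:T. lattice_points s k (N - c * t))"
    obtain t x where tx: "y = (t, x)" by force
    have x: "x \<in> extensional {1..s}" "(\<Sum>i=1..s. k i * x i) \<le> N - c * t" "c * t \<le> N"
      using y by (auto simp: tx lattice_points_def T_def PiE_iff)
    then have "x (Suc s) = undefined"
      by (simp add: extensional_def)
    then show "(\<lambda>x. (x (Suc s), x(Suc s := undefined))) (case y of (t, x) \<Rightarrow> x(Suc s := t)) = y"
      by (auto simp: tx)
    show "(case y of (t, x) \<Rightarrow> x(Suc s := t)) \<in> lattice_points (Suc s) k N"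
      using x by (auto simp: tx lattice_points_def c_def sum_upd PiE_iff extensional_def)
  qed
  also have "\<dots> = (\<Sum>t\<in>T. \<Sum>x\<in>lattice_points s k (N - c * t).
      w (Suc s) t * (\<Prod>i=1..s. w i (x i)))"
    by (rule sum.Sigma[symmetric]) (use finT k in \<open>auto intro: finite_lattice_points\<close>)
  also have "\<dots> = (\<Sum>t\<in>T. ?u (c * t) * ?W (N - c * t))"
    using c by (simp add: c_def[symmetric] sum_distrib_left)
  \<comment> \<open>As \<open>c > 0\<close>, the map from \<open>t\<close> to
    \<open>j = c * t\<close> is injective. At the remaining \<open>j \<le> N\<close> the factor
    \<open>?u\<close> vanishes, so the sum can then range over all of them.\<close>
  also have "\<dots> = (\<Sum>j\<in>(\<lambda>t. c * t) ` T. ?u j * ?W (N - j))"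
    using c by (subst sum.reindex) (auto simp: inj_on_def)
  also have "\<dots> = (\<Sum>j\<le>N. ?u j * ?W (N - j))"
  proof (rule sum.mono_neutral_left)
    show "\<forall>j\<in>{..N} - (\<lambda>t. c * t) ` T. ?u j * ?W (N - j) = 0"
      by (auto simp: c_def[symmetric] T_def elim!: dvdE)
  qed (auto simp: T_def)
  finally show ?thesis .
qed

text \<open>By induction on \<open>s\<close>, the last variable enters through a Cauchy product,
  which adds its exponent and 1 to the degree. \<open>L\<close> is any common multiple rather than
  the least one, so that it stays fixed while \<open>s\<close> varies.\<close>

lemma quasi_poly_seq_sum_lattice_points:
  assumes "\<And>i. i \<in> {1..s} \<Longrightarrow> k i > 0" and "\<And>i. i \<in> {1..s} \<Longrightarrow> k i dvd L"
  shows "quasi_poly_seq L ((\<Sum>i=1..s. a i) + s)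
    (\<lambda>N. \<Sum>x\<in>lattice_points s k N. \<Prod>i=1..s. of_nat (x i) ^ a i :: 'a::field_char_0)"
  using assms
proof (induction s)
  case 0
  \<comment> \<open>Only the empty tuple is left, and its empty product gives the constant sequence
    1.\<close>
  have "lattice_points 0 k N = {\<lambda>_. undefined}" for N
    by (auto simp: lattice_points_def)
  then show ?case
    by (simp add: quasi_poly_seq_const)
next
  case (Suc s)
  have "quasi_poly_seq L ((\<Sum>i=1..s. a i) + s)
    (\<lambda>N. \<Sum>x\<in>lattice_points s k N. \<Prod>i=1..s. of_nat (x i) ^ a i :: 'a)"
    by (rule Suc.IH) (use Suc.prems in auto)
  moreover have "quasi_poly_seq L (a (Suc s))
      (\<lambda>j. if k (Suc s) dvd j then of_nat (j div k (Suc s)) ^ a (Suc s) else 0 :: 'a)"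
    by (rule quasi_poly_seq_power_div) (use Suc.prems in auto)
  ultimately have "quasi_poly_seq L (a (Suc s) + ((\<Sum>i=1..s. a i) + s) + 1)
    (\<lambda>N. \<Sum>j\<le>N. (if k (Suc s) dvd j then of_nat (j div k (Suc s)) ^ a (Suc s) else 0) *
       (\<Sum>x\<in>lattice_points s k (N - j). \<Prod>i=1..s. of_nat (x i) ^ a i) :: 'a)"
    by (rule quasi_poly_seq_cauchy_product[rotated])
  then show ?case
    by (subst sum_lattice_points_Suc) (use Suc.prems in \<open>auto simp: add_ac\<close>)
qed

section \<open>Reduction to monomials\<close>

lemma quasi_poly_seq_lattice_sum:
  assumes k: "\<And>i. i \<in> {1..s} \<Longrightarrow> k i > 0" "\<And>i. i \<in> {1..s} \<Longrightarrow> k i dvd L"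
    and vars: "mpoly_vars P \<subseteq> {1..Suc s}"
  shows "quasi_poly_seq L (mpoly_degree P + s) (lattice_sum s k P)"
proof -
  let ?e = "Poly_Mapping.lookup"
  have keys: "Poly_Mapping.keys m \<subseteq> {1..Suc s}" if "m \<in> Poly_Mapping.keys P" for m
    using vars that by (auto simp: mpoly_vars_def)
  have eval: "mpoly_eval P (\<lambda>i. of_nat ((x(Suc s := N)) i)) =
      (\<Sum>m\<in>Poly_Mapping.keys P. ?e P m *
        (of_nat N ^ ?e m (Suc s) * (\<Prod>i=1..s. of_nat (x i) ^ ?e m i)))" for x N
    unfolding mpoly_eval_def
  proof (intro sum.cong refl arg_cong2[where f = "(*)"])
    fix m assume m: "m \<in> Poly_Mapping.keys P"
    \<comment> \<open>Variables absent from \<open>m\<close> have exponent 0 and contribute the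
      factor 1, so the product may run over all \<open>s + 1\<close> variables.\<close>
    have "(\<Prod>i\<in>Poly_Mapping.keys m. of_nat ((x(Suc s := N)) i) ^ ?e m i) =
        (\<Prod>i=1..Suc s. of_nat ((x(Suc s := N)) i) ^ ?e m i :: rat)"
      by (rule prod.mono_neutral_left) (use keys[OF m] in \<open>auto simp: in_keys_iff\<close>)
    also have "\<dots> = of_nat N ^ ?e m (Suc s) * (\<Prod>i=1..s. of_nat ((x(Suc s := N)) i) ^ ?e m i)"
      by (simp add: mult.commute)
    also have "(\<Prod>i=1..s. of_nat ((x(Suc s := N)) i) ^ ?e m i) =
        (\<Prod>i=1..s. of_nat (x i) ^ ?e m i :: rat)"
      by (rule prod.cong) auto
    finally show "(\<Prod>i\<in>Poly_Mapping.keys m. of_nat ((x(Suc s := N)) i) ^ ?e m i) =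
        (of_nat N ^ ?e m (Suc s) * (\<Prod>i=1..s. of_nat (x i) ^ ?e m i) :: rat)" .
  qed
  have "lattice_sum s k P = (\<lambda>N. \<Sum>m\<in>Poly_Mapping.keys P. ?e P m *
      (of_nat N ^ ?e m (Suc s) *
        (\<Sum>x\<in>lattice_points s k N. \<Prod>i=1..s. of_nat (x i) ^ ?e m i)))"
    unfolding lattice_sum_def eval by (subst sum.swap) (simp add: sum_distrib_left)
  moreover have "quasi_poly_seq L (mpoly_degree P + s)
      (\<lambda>N. of_nat N ^ ?e m (Suc s) *
        (\<Sum>x\<in>lattice_points s k N. \<Prod>i=1..s. of_nat (x i) ^ ?e m i) :: rat)"
    if m: "m \<in> Poly_Mapping.keys P" for m
  proof (rule quasi_poly_seq_mono)
    show "quasi_poly_seq L (?e m (Suc s) + ((\<Sum>i=1..s. ?e m i) + s))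
      (\<lambda>N. of_nat N ^ ?e m (Suc s) *
        (\<Sum>x\<in>lattice_points s k N. \<Prod>i=1..s. of_nat (x i) ^ ?e m i) :: rat)"
      by (intro quasi_poly_seq_mult quasi_poly_seq_of_nat_power
          quasi_poly_seq_sum_lattice_points k)
    \<comment> \<open>The exponents of the \<open>s\<close> coordinates and of \<open>N\<close>
      together make up the degree of the monomial, so summation over lattice points costs only the
      extra \<open>s\<close>.\<close>
    have "(\<Sum>i=1..Suc s. ?e m i) = monom_degree m"
      unfolding monom_degree_def
      by (rule sum.mono_neutral_right) (use keys[OF m] in \<open>auto simp: in_keys_iff\<close>)
    also have "\<dots> \<le> mpoly_degree P"
      unfolding mpoly_degree_def using m by (intro Max_ge) auto
    finally show "?e m (Suc s) + ((\<Sum>i=1..s. ?e m i) + s) \<le> mpoly_degree P + s"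
      by simp
  qed
  ultimately show ?thesis
    by (auto intro!: quasi_poly_seq_sum quasi_poly_seq_cmult)
qed

section \<open>Polynomials in the quotient \<open>M\<close> and in \<open>N\<close>\<close>

theorem proposition2p14:
  fixes s q L :: nat and k :: "nat \<Rightarrow> nat" and P :: "rat mpoly"
  assumes "s \<ge> 1"
    and "\<And>i. i \<in> {1..s} \<Longrightarrow> k i > 0"
    and "mpoly_vars P \<subseteq> {1..Suc s}"
    and "mpoly_degree P = q"
    and "L = Lcm (k ` {1..s})"
  shows "\<forall>R<L.
    (\<exists>g :: rat poly. degree g \<le> q + s \<and>
      (\<forall>N M. N = L * M + R \<longrightarrow> lattice_sum s k P N = poly g (of_nat N))) \<and>
    (\<exists>h :: rat poly. degree h \<le> q + s \<and>
      (\<forall>N M. N = L * M + R \<longrightarrow> lattice_sum s k P N = poly h (of_nat M)))"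
proof (intro allI impI)
  fix R assume R: "R < L"
  have "quasi_poly_seq L (q + s) (lattice_sum s k P)"
    using quasi_poly_seq_lattice_sum[of s k L P] assms by auto
  from quasi_poly_seqD[OF this R]
  obtain h where h: "degree h \<le> q + s" "\<And>M. lattice_sum s k P (L * M + R) = poly h (of_nat M)"
    by (rule poly_seqE) blast
  \<comment> \<open>\<open>g\<close> substitutes \<open>M = (N - R) / L\<close>, the inverse of
    \<open>N = L * M + R\<close>. Here \<open>R < L\<close> ensures \<open>L \<noteq> 0\<close>, and
    an affine substitution does not raise the degree.\<close>
  define g where "g = h \<circ>\<^sub>p [:- of_nat R / of_nat L, 1 / of_nat L:]"
  have "degree g \<le> q + s"
    using h(1) R by (simp add: g_def degree_pcompose)
  moreover have "poly g (of_nat (L * M + R)) = poly h (of_nat M)" for M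
  proof -
    have "- of_nat R / of_nat L + of_nat (L * M + R) * (1 / of_nat L) = (of_nat M :: rat)"
      using R by (simp add: field_simps)
    then show ?thesis
      by (simp add: g_def poly_pcompose del: of_nat_add of_nat_mult)
  qed
  ultimately show "(\<exists>g :: rat poly. degree g \<le> q + s \<and>
      (\<forall>N M. N = L * M + R \<longrightarrow> lattice_sum s k P N = poly g (of_nat N))) \<and>
    (\<exists>h :: rat poly. degree h \<le> q + s \<and>
      (\<forall>N M. N = L * M + R \<longrightarrow> lattice_sum s k P N = poly h (of_nat M)))"
    using h by metis
qed

end
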